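(* Let $G$ be a connected graph of order $n$ with diameter $2$. Let $U(G)$ be the set of universal vertices of $G$, let $u=|U(G)|$, and let $G'$ be the subgraph of $G$ induced by $V(G)\setminus U(G)$. Then, with the vertices ordered so that those of $U(G)$ come first, $$\mathcal{E}^{\mathcal{L}}(G)=\begin{bmatrix} nI-J & -J\\ -J & (2n-u)I-2J-2\mathcal{L}(G')\end{bmatrix}.$$
   Context: Graphs are finite, simple and undirected. A universal vertex of a graph of order $n$ is a vertex of degree $n-1$. $I$ and $J$ denote the identity and all-ones matrices of appropriate orders (if $u=0$, only the lower right block is present). $\mathcal{L}(H)=\mathrm{Diag}(\mathrm{Deg}(H))-\mathcal{A}(H)$ is the usual Laplacian of a graph $H$ (diagonal degree matrix minus adjacency matrix). For a connected graph $G$ with vertices $v_1,\dots,v_n$, $d(v_i,v_j)$ is the length of a shortest path and $e(v_i)=\max_j d(v_i,v_j)$. The eccentricity matrix $\mathcal{E}(G)$ has entries $\mathcal{E}_{ij}(G)=d(v_i,v_j)$ if $d(v_i,v_j)=\min\{e(v_i),e(v_j)\}$ and $\mathcal{E}_{ij}(G)=0$ if $d(v_i,v_j)<\min\{e(v_i),e(v_j)\}$. Put $\mathrm{Tr}_{\mathcal{E}}(v_i)=\sum_j\mathcal{E}_{ij}(G)$; the eccentricity Laplacian is $\mathcal{E}^{\mathcal{L}}(G)=\mathrm{Diag}(\mathrm{Tr}_{\mathcal{E}}(G))-\mathcal{E}(G)$, where $\mathrm{Diag}(\mathrm{Tr}_{\mathcal{E}}(G))$ is the diagonal matrix of the numbers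 $\mathrm{Tr}_{\mathcal{E}}(v_i)$. *)

theory Defs
  imports "Graph_Theory.Digraph_Component" "Graph_Theory.Shortest_Path" "Jordan_Normal_Form.Matrix"
begin

text \<open>
  A finite simple undirected graph is an instance of the locale \<^locale>\<open>graph\<close>: a finite,
  loop-free, symmetric digraph without parallel arcs, an edge being a pair of opposite arcs. The
  degree of a vertex is therefore its \<^const>\<open>out_degree\<close>. A matrix indexed by vertices depends
  on an ordering of them, which is passed as a list.
\<close>

subsection \<open>Distances\<close>

text \<open>Only meaningful for vertices joined by a path.\<close>
definition gdist :: "('a, 'b) pre_digraph \<Rightarrow> 'a \<Rightarrow> 'a \<Rightarrow> nat" where
  "gdist G v w = (LEAST k. \<exists>p. pre_digraph.apath G v p w \<and> length p = k)"

lemma (in fin_digraph) gdist_eq_mu: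
  assumes "v \<rightarrow>\<^sup>* w"
  shows "ereal (real (gdist G v w)) = \<mu> (\<lambda>_. 1) v w"
proof -
  have cost: "awalk_cost (\<lambda>_. 1) p = real (length p)" for p :: "'b awalk"
    by (induction p) auto
  obtain p where p: "apath v p w" "\<mu> (\<lambda>_. 1) v w = ereal (real (length p))"
    using min_cost_awalk[OF assms, of "\<lambda>_. 1"] by (auto simp: cost)
  have "length p \<le> length q" if "apath v q w" for q
    using min_cost_le_walk_cost[of v q w "\<lambda>_. 1"] that p(2)
    by (auto simp: cost dest: awalkI_apath)
  then have "gdist G v w = length p"
    unfolding gdist_def using p(1) by (intro Least_equality) auto
  then show ?thesis using p(2) by simp
qed

definition ecc :: "('a, 'b) pre_digraph \<Rightarrow> 'a \<Rightarrow> nat" where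
  "ecc G v = Max (gdist G v ` verts G)"

definition gdiameter :: "('a, 'b) pre_digraph \<Rightarrow> nat" where
  "gdiameter G = Max (ecc G ` verts G)"

definition universal_verts :: "('a, 'b) pre_digraph \<Rightarrow> 'a set" where
  "universal_verts G = {v \<in> verts G. out_degree G v = card (verts G) - 1}"

subsection \<open>Matrices\<close>

definition ones_mat :: "nat \<Rightarrow> nat \<Rightarrow> real mat" where
  "ones_mat nr nc = mat nr nc (\<lambda>_. 1)"

definition adjacency_mat :: "('a, 'b) pre_digraph \<Rightarrow> 'a list \<Rightarrow> real mat" where
  "adjacency_mat G vs =
     mat (length vs) (length vs) (\<lambda>(i, j). if vs ! i \<rightarrow>\<^bsub>G\<^esub> vs ! j then 1 else 0)"

definition laplacian_mat :: "('a, 'b) pre_digraph \<Rightarrow> 'a list \<Rightarrow> real mat" where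
  "laplacian_mat G vs = mat_diag (length vs) (\<lambda>i. real (out_degree G (vs ! i))) - adjacency_mat G vs"

text \<open>
  Since \<open>gdist G v w\<close> never exceeds \<open>min (ecc G v) (ecc G w)\<close> in a connected graph, the second
  branch is the case of strict inequality.
\<close>
definition ecc_entry :: "('a, 'b) pre_digraph \<Rightarrow> 'a \<Rightarrow> 'a \<Rightarrow> real" where
  "ecc_entry G v w =
     (if gdist G v w = min (ecc G v) (ecc G w) then real (gdist G v w) else 0)"

definition ecc_mat :: "('a, 'b) pre_digraph \<Rightarrow> 'a list \<Rightarrow> real mat" where
  "ecc_mat G vs = mat (length vs) (length vs) (\<lambda>(i, j). ecc_entry G (vs ! i) (vs ! j))"

definition ecc_transmission :: "('a, 'b) pre_digraph \<Rightarrow> 'a \<Rightarrow> real" where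
  "ecc_transmission G v = (\<Sum>w\<in>verts G. ecc_entry G v w)"

definition ecc_laplacian_mat :: "('a, 'b) pre_digraph \<Rightarrow> 'a list \<Rightarrow> real mat" where
  "ecc_laplacian_mat G vs = mat_diag (length vs) (\<lambda>i. ecc_transmission G (vs ! i)) - ecc_mat G vs"

end

theory Submission
  imports Defs
begin

text \<open>
  In a connected graph of diameter two every vertex has eccentricity one or two, and eccentricity
  one characterises the universal vertices. Two distinct vertices are at distance one or two,
  according as they are adjacent or not. Hence the eccentricity matrix keeps only these distances:
  the ones between a universal vertex and any other vertex, where the smaller eccentricity is one
  (\<open>ecc_entry_universal\<close>), and the twos between distinct non-adjacent vertices. Among the
  non-universal vertices \<open>W\<close> it is thus twice the adjacency matrix of the complement of \<open>G'\<close>,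
  that is \<open>2 J - 2 I - 2 A(G')\<close> (\<open>ecc_entry_nonuniversal\<close>).

  Summing rows yields the diagonal. A universal vertex has transmission \<open>n - 1\<close>. A vertex \<open>v\<close> in
  \<open>W\<close> receives \<open>1\<close> from each of the \<open>u\<close> universal vertices and \<open>2\<close> from each of its
  \<open>n - u - 1 - deg v\<close> non-neighbours in \<open>G'\<close>, so its transmission is
  \<open>2 n - u - 2 - 2 deg v\<close> (\<open>ecc_transmission_nonuniversal\<close>); the degree terms on the diagonal and
  the adjacency terms off it combine to the Laplacian of \<open>G'\<close>.
\<close>

section \<open>Degrees and neighbourhoods\<close>

lemma (in nomulti_digraph) inj_on_head_out_arcs: "inj_on (head G) (out_arcs G v)"
  by (rule inj_onI) (auto intro: no_multi_arcs simp: arc_to_ends_def)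

lemma (in nomulti_digraph) out_degree_eq_card_neighbours:
  "out_degree G v = card {w \<in> verts G. v \<rightarrow>\<^bsub>G\<^esub> w}"
proof -
  have "head G ` out_arcs G v = {w \<in> verts G. v \<rightarrow>\<^bsub>G\<^esub> w}"
    by (auto simp: arcs_ends_conv)
  then show ?thesis
    using card_image[OF inj_on_head_out_arcs[of v]] by (simp add: out_degree_def)
qed

lemma dominates_induce_subgraph_iff:
  assumes "v \<in> S" "w \<in> S"
  shows "v \<rightarrow>\<^bsub>G \<restriction> S\<^esub> w \<longleftrightarrow> v \<rightarrow>\<^bsub>G\<^esub> w"
  using assms by (auto simp: arcs_ends_conv)

lemma (in nomulti_digraph) out_degree_induce_subgraph:
  assumes "v \<in> S"
  shows "out_degree (G \<restriction> S) v = card {w \<in> S. v \<rightarrow>\<^bsub>G\<^esub> w}"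
proof -
  interpret H: nomulti_digraph "G \<restriction> S"
    by unfold_locales (auto intro: no_multi_arcs simp: arc_to_ends_def)
  have "{w \<in> verts (G \<restriction> S). v \<rightarrow>\<^bsub>G \<restriction> S\<^esub> w} = {w \<in> S. v \<rightarrow>\<^bsub>G\<^esub> w}"
    using assms dominates_induce_subgraph_iff[of v S _ G] by auto
  then show ?thesis by (simp add: H.out_degree_eq_card_neighbours)
qed

lemma (in loopfree_digraph) not_dominates_self: "\<not> v \<rightarrow>\<^bsub>G\<^esub> v"
proof
  assume "v \<rightarrow>\<^bsub>G\<^esub> v"
  then obtain e where "e \<in> arcs G" "(v, v) = (tail G e, head G e)"
    unfolding arcs_ends_conv by blast
  then show False using no_loops[of e] by (metis Pair_inject)
qed

text \<open>
  Without loops and parallel arcs the degree counts a subset of the other vertices, so it attains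
  its maximum exactly when every other vertex is a neighbour.
\<close>
lemma (in digraph) universal_verts_iff:
  assumes "v \<in> verts G"
  shows "v \<in> universal_verts G \<longleftrightarrow> (\<forall>w \<in> verts G. w \<noteq> v \<longrightarrow> v \<rightarrow>\<^bsub>G\<^esub> w)"
proof -
  define N where "N = {w \<in> verts G. v \<rightarrow>\<^bsub>G\<^esub> w}"
  have sub: "N \<subseteq> verts G - {v}"
    unfolding N_def using not_dominates_self[of v] by blast
  have "finite (verts G - {v})" by simp
  then have "card N = card (verts G - {v}) \<longleftrightarrow> N = verts G - {v}"
    using sub by (metis card_subset_eq)
  moreover have "N = verts G - {v} \<longleftrightarrow> (\<forall>w \<in> verts G. w \<noteq> v \<longrightarrow> v \<rightarrow>\<^bsub>G\<^esub> w)"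
    unfolding N_def using not_dominates_self[of v] by blast
  ultimately show ?thesis
    using assms by (simp add: universal_verts_def out_degree_eq_card_neighbours flip: N_def)
qed

section \<open>Small distances\<close>

context wf_digraph
begin

lemma gdist_self [simp]: "v \<in> verts G \<Longrightarrow> gdist G v v = 0"
  unfolding gdist_def by (rule Least_eq_0) (auto simp: apath_Nil_iff)

lemma apath_of_length_gdist:
  assumes "v \<rightarrow>\<^sup>* w"
  obtains p where "apath v p w" "length p = gdist G v w"
proof -
  obtain q where "apath v q w"
    using assms apath_awalk_to_apath by (auto simp: reachable_awalk)
  then have "\<exists>k p. apath v p w \<and> length p = k" by blast
  from LeastI_ex[OF this] show thesis
    using that unfolding gdist_def by blast
qed

lemma gdist_eq_0_iff:
  assumes "v \<rightarrow>\<^sup>* w"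
  shows "gdist G v w = 0 \<longleftrightarrow> v = w"
proof
  assume "gdist G v w = 0"
  with apath_of_length_gdist[OF assms] show "v = w"
    by (metis apath_Nil_iff length_0_conv)
next
  assume "v = w"
  with assms show "gdist G v w = 0"
    using reachable_in_verts by auto
qed

lemma gdist_le_1_if_dominates:
  assumes "v \<rightarrow>\<^bsub>G\<^esub> w" "v \<noteq> w"
  shows "gdist G v w \<le> 1"
proof -
  obtain e where "e \<in> arcs G" "tail G e = v" "head G e = w"
    using assms by (auto simp: arcs_ends_conv)
  then have "apath v [e] w"
    using assms by (auto simp: apath_simps)
  then show ?thesis
    unfolding gdist_def by (intro Least_le exI[of _ "[e]"]) simp
qed

lemma dominates_if_gdist_eq_1:
  assumes "v \<rightarrow>\<^sup>* w" "gdist G v w = 1"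
  shows "v \<rightarrow>\<^bsub>G\<^esub> w"
proof -
  obtain p where "apath v p w" "length p = 1"
    using apath_of_length_gdist assms by metis
  then obtain e where "apath v [e] w"
    by (auto simp: length_Suc_conv)
  then show ?thesis by (auto simp: apath_simps arcs_ends_conv)
qed

end

section \<open>Graphs of diameter two\<close>

locale diameter_two_graph = graph +
  assumes connected: "connected G"
    and diameter: "gdiameter G = 2"
begin

abbreviation "U \<equiv> universal_verts G"
abbreviation "W \<equiv> verts G - universal_verts G"

lemma universal_verts_subset: "U \<subseteq> verts G"
  by (auto simp: universal_verts_def)

lemma reachable: "v \<in> verts G \<Longrightarrow> w \<in> verts G \<Longrightarrow> v \<rightarrow>\<^sup>* w"
  using symmetric_connected_imp_strongly_connected[OF sym_arcs connected] by auto

lemma gdist_le_ecc: "w \<in> verts G \<Longrightarrow> gdist G v w \<le> ecc G v"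
  unfolding ecc_def by (rule Max_ge) auto

lemma gdist_le_2: "v \<in> verts G \<Longrightarrow> w \<in> verts G \<Longrightarrow> gdist G v w \<le> 2"
  using gdist_le_ecc[of w v] Max_ge[of "ecc G ` verts G" "ecc G v"] diameter
  unfolding gdiameter_def by simp

text \<open>The diameter bound leaves only the distance two for distinct non-adjacent vertices.\<close>
lemma gdist_eq:
  assumes "v \<in> verts G" "w \<in> verts G"
  shows "gdist G v w = (if v = w then 0 else if v \<rightarrow>\<^bsub>G\<^esub> w then 1 else 2)"
  using gdist_eq_0_iff[OF reachable[OF assms]] gdist_le_2[OF assms]
    gdist_le_1_if_dominates[of v w] dominates_if_gdist_eq_1[OF reachable[OF assms]]
  by fastforce

text \<open>
  A one-vertex graph has diameter zero. This is what keeps the eccentricity of a universal vertex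
  from being zero.
\<close>
lemma ex_other_vertex:
  assumes "v \<in> verts G"
  obtains w where "w \<in> verts G" "w \<noteq> v"
proof (rule ccontr)
  assume "\<not> thesis"
  with that assms have "verts G = {v}" by auto
  then have "gdiameter G = 0" by (simp add: gdiameter_def ecc_def)
  with diameter show False by simp
qed

lemma ecc_eq:
  assumes "v \<in> verts G"
  shows "ecc G v = (if v \<in> U then 1 else 2)"
proof (cases "v \<in> U")
  case True
  then have dist: "gdist G v w = (if v = w then 0 else 1)" if "w \<in> verts G" for w
    using that assms by (auto simp: gdist_eq universal_verts_iff)
  obtain x where x: "x \<in> verts G" "x \<noteq> v"
    using ex_other_vertex[OF assms] .
  have "ecc G v = 1" unfolding ecc_def
    by (rule Max_eqI) (use x dist in \<open>force+\<close>)
  with True show ?thesis by simp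
next
  case False
  then obtain x where x: "x \<in> verts G" "x \<noteq> v" "\<not> v \<rightarrow>\<^bsub>G\<^esub> x"
    using universal_verts_iff[OF assms] by auto
  have "ecc G v = 2" unfolding ecc_def
  proof (rule Max_eqI)
    show "2 \<in> gdist G v ` verts G"
      using x assms by (intro image_eqI[of _ _ x]) (simp_all add: gdist_eq)
  qed (use assms gdist_le_2 in auto)
  with False show ?thesis by simp
qed

section \<open>Entries and row sums of the eccentricity matrix\<close>

lemma ecc_entry_self [simp]: "v \<in> verts G \<Longrightarrow> ecc_entry G v v = 0"
  by (simp add: ecc_entry_def)

text \<open>
  A universal vertex has eccentricity one, so the minimum in the definition of the entry is the
  distance of the two adjacent vertices.
\<close>
lemma ecc_entry_universal:
  assumes "v \<in> verts G" "w \<in> verts G" "v \<noteq> w" "v \<in> U \<or> w \<in> U"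
  shows "ecc_entry G v w = 1"
proof -
  have "v \<rightarrow>\<^bsub>G\<^esub> w"
    using assms(4)
  proof
    assume "v \<in> U"
    with universal_verts_iff[OF assms(1)] assms(2,3) show ?thesis by auto
  next
    assume "w \<in> U"
    with universal_verts_iff[OF assms(2)] assms(1,3) have "w \<rightarrow>\<^bsub>G\<^esub> v" by auto
    then show ?thesis by (rule graph_symmetric)
  qed
  then have "gdist G v w = 1"
    using gdist_eq[OF assms(1,2)] assms(3) by simp
  moreover have "min (ecc G v) (ecc G w) = 1"
    using assms(4) by (auto simp only: ecc_eq[OF assms(1)] ecc_eq[OF assms(2)] split: if_splits)
  ultimately show ?thesis by (simp add: ecc_entry_def)
qed

text \<open>
  Both eccentricities are two, so exactly the pairs at distance two survive. Since a vertex is not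
  adjacent to itself, the two indicators never overlap; this linear form is what lets the row sums
  be evaluated term by term.
\<close>
lemma ecc_entry_nonuniversal:
  assumes "v \<in> W" "w \<in> W"
  shows "ecc_entry G v w = 2 - 2 * of_bool (w = v) - 2 * of_bool (v \<rightarrow>\<^bsub>G\<^esub> w)"
proof -
  have verts: "v \<in> verts G" "w \<in> verts G" using assms by simp_all
  have "min (ecc G v) (ecc G w) = 2"
    using assms by (simp add: ecc_eq)
  then show ?thesis
    by (simp add: ecc_entry_def gdist_eq[OF verts] not_dominates_self)
qed

lemma ecc_transmission_universal:
  assumes "v \<in> U"
  shows "ecc_transmission G v = real (card (verts G)) - 1"
proof -
  have v: "v \<in> verts G" using assms universal_verts_subset by auto
  have "ecc_transmission G v = (\<Sum>w\<in>verts G - {v}. ecc_entry G v w)"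
    unfolding ecc_transmission_def using v by (simp add: sum.remove)
  also have "\<dots> = (\<Sum>w\<in>verts G - {v}. 1)"
    using v assms by (intro sum.cong) (auto simp: ecc_entry_universal)
  also have "\<dots> = real (card (verts G)) - 1"
    using v card_gt_0_iff[of "verts G"] by (auto simp: of_nat_diff Suc_leI)
  finally show ?thesis .
qed

text \<open>
  Summing the linear form of the entries over \<open>W\<close> turns the adjacency indicator into the degree
  in the graph induced on \<open>W\<close>; the universal vertices contribute one each.
\<close>
lemma ecc_transmission_nonuniversal:
  assumes "v \<in> W"
  shows "ecc_transmission G v
    = 2 * real (card (verts G)) - real (card U) - 2 - 2 * real (out_degree (G \<restriction> W) v)"
proof -
  have "(\<Sum>w\<in>U. ecc_entry G v w) = (\<Sum>w\<in>U. 1)"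
    using assms universal_verts_subset by (intro sum.cong refl ecc_entry_universal) auto
  then have sum_U: "(\<Sum>w\<in>U. ecc_entry G v w) = real (card U)"
    by simp
  have "{w \<in> W. w = v} = {v}" using assms by auto
  then have self: "(\<Sum>w\<in>W. of_bool (w = v)) = (1 :: real)"
    by (simp add: sum_of_bool_eq Int_def)
  have nbs: "(\<Sum>w\<in>W. of_bool (v \<rightarrow>\<^bsub>G\<^esub> w)) = real (out_degree (G \<restriction> W) v)"
    using assms by (simp add: out_degree_induce_subgraph sum_of_bool_eq Int_def)
  have "(\<Sum>w\<in>W. ecc_entry G v w)
      = (\<Sum>w\<in>W. 2 - 2 * of_bool (w = v) - 2 * of_bool (v \<rightarrow>\<^bsub>G\<^esub> w))"
    using assms by (intro sum.cong refl ecc_entry_nonuniversal)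
  also have "\<dots> = 2 * real (card W) - 2 * (\<Sum>w\<in>W. of_bool (w = v))
      - 2 * (\<Sum>w\<in>W. of_bool (v \<rightarrow>\<^bsub>G\<^esub> w))"
    by (simp only: sum_subtractf sum_distrib_left sum_constant mult.commute[of "of_nat (card W)"])
  finally have sum_W: "(\<Sum>w\<in>W. ecc_entry G v w)
      = 2 * real (card W) - 2 - 2 * real (out_degree (G \<restriction> W) v)"
    by (simp only: self nbs mult_1_right)
  have "finite U" using universal_verts_subset finite_verts by (rule finite_subset)
  then have card_W: "real (card W) = real (card (verts G)) - real (card U)"
    using card_mono[OF finite_verts universal_verts_subset] universal_verts_subset
    by (simp add: card_Diff_subset)
  have "ecc_transmission G v = (\<Sum>w\<in>W. ecc_entry G v w) + (\<Sum>w\<in>U. ecc_entry G v w)"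
    unfolding ecc_transmission_def
    using universal_verts_subset finite_verts by (rule sum.subset_diff)
  with sum_U sum_W card_W show ?thesis by linarith
qed

end

section \<open>The block form of the eccentricity Laplacian\<close>

theorem theorem3p3:
  fixes G G' :: "('a, 'b) pre_digraph" and us ws :: "'a list" and n u :: nat
  assumes "graph G"
    and "Digraph_Component.connected G"
    and "n = card (verts G)"
    and "gdiameter G = 2"
    and "u = card (universal_verts G)"
    and "G' = G \<restriction> (verts G - universal_verts G)"
    and "distinct us" and "set us = universal_verts G"
    and "distinct ws" and "set ws = verts G - universal_verts G"
  shows "ecc_laplacian_mat G (us @ ws) =
    four_block_mat
      (real n \<cdot>\<^sub>m 1\<^sub>m u - ones_mat u u)  (- ones_mat u (n - u))
      (- ones_mat (n - u) u)
        ((2 * real n - real u) \<cdot>\<^sub>m 1\<^sub>m (n - u) - 2 \<cdot>\<^sub>m ones_mat (n - u) (n - u)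
          - 2 \<cdot>\<^sub>m laplacian_mat G' ws)"
proof -
  interpret diameter_two_graph G
    using assms(1,2,4) by (simp add: diameter_two_graph_def diameter_two_graph_axioms_def)
  have len_us: "length us = u"
    using assms(5,7,8) distinct_card by metis
  have len_ws: "length ws = n - u"
    using assms(3,5,9,10) distinct_card[of ws] universal_verts_subset finite_verts
    by (metis card_Diff_subset finite_subset)
  have us: "us ! i \<in> U" "us ! i \<in> verts G" if "i < u" for i
    using nth_mem[of i us] that len_us assms(8) universal_verts_subset by auto
  have ws: "ws ! i \<in> W" "ws ! i \<in> verts G" if "i < n - u" for i
    using nth_mem[of i ws] that len_ws assms(10) by auto
  have us_eq: "us ! i = us ! j \<longleftrightarrow> i = j" if "i < u" "j < u" for i j
    using that len_us assms(7) by (simp add: nth_eq_iff_index_eq)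
  have ws_eq: "ws ! i = ws ! j \<longleftrightarrow> i = j" if "i < n - u" "j < n - u" for i j
    using that len_ws assms(9) by (simp add: nth_eq_iff_index_eq)
  have us_ws: "us ! i \<noteq> ws ! j" if "i < u" "j < n - u" for i j
    using us(1)[OF that(1)] ws(1)[OF that(2)] by auto
  show ?thesis (is "?L = ?R")
  proof (rule eq_matI)
    show "dim_row ?L = dim_row ?R" "dim_col ?L = dim_col ?R"
      by (simp_all add: ecc_laplacian_mat_def ecc_mat_def laplacian_mat_def adjacency_mat_def
          ones_mat_def len_us len_ws)
  next
    fix i j assume "i < dim_row ?R" "j < dim_col ?R"
    then have ij: "i < u + (n - u)" "j < u + (n - u)"
      by (simp_all add: laplacian_mat_def adjacency_mat_def ones_mat_def len_ws)
    have L: "?L $$ (i, j) = (if i = j then ecc_transmission G ((us @ ws) ! j) else 0)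
        - ecc_entry G ((us @ ws) ! i) ((us @ ws) ! j)"
      using ij by (simp add: ecc_laplacian_mat_def ecc_mat_def mat_diag_def len_us len_ws)
    consider (UU) "i < u" "j < u" | (UW) j' where "i < u" "j = u + j'" "j' < n - u"
      | (WU) i' where "i = u + i'" "i' < n - u" "j < u"
      | (WW) i' j' where "i = u + i'" "i' < n - u" "j = u + j'" "j' < n - u"
      using ij by (metis add_less_cancel_left le_add_diff_inverse not_le)
    then show "?L $$ (i, j) = ?R $$ (i, j)"
    proof cases
      case UU
      then show ?thesis
        using L us[of i] us[of j] us_eq[of i j] assms(3)
        by (simp add: nth_append len_us len_ws ones_mat_def laplacian_mat_def adjacency_mat_def
            ecc_transmission_universal ecc_entry_universal)
    next
      case UW
      then show ?thesis
        using L us[of i] ws[of j'] us_ws[of i j']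
        by (simp add: nth_append len_us len_ws ones_mat_def laplacian_mat_def adjacency_mat_def
            ecc_entry_universal)
    next
      case WU
      then show ?thesis
        using L us[of j] ws[of i'] us_ws[of j i'] ecc_entry_universal[of "ws ! i'" "us ! j"]
        by (auto simp add: nth_append len_us len_ws ones_mat_def laplacian_mat_def adjacency_mat_def)
    next
      case WW
      have "ws ! i' \<rightarrow>\<^bsub>G'\<^esub> ws ! j' \<longleftrightarrow> ws ! i' \<rightarrow>\<^bsub>G\<^esub> ws ! j'"
        using WW ws(1) assms(6) dominates_induce_subgraph_iff by metis
      then show ?thesis
        using WW L ws[of i'] ws[of j'] ws_eq[of i' j'] not_dominates_self[of "ws ! i'"] assms(3,5,6)
        by (auto simp add: nth_append len_us len_ws ones_mat_def laplacian_mat_def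
            adjacency_mat_def mat_diag_def ecc_transmission_nonuniversal ecc_entry_nonuniversal)
    qed
  qed
qed

end
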